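(* Let $x^L,x^U\in\mathbb{R}^2$ with $x^L_i<x^U_i$, let $f_i:[x_i^L,x_i^U]\to\mathbb{R}$ for $i=1,2$, let $D\subseteq[x^L,x^U]:=[x_1^L,x_1^U]\times[x_2^L,x_2^U]$, and let $$\mathcal{G}:=\bigl\{(x,\mu)\in\mathbb{R}^3 : \mu=f_1(x_1)f_2(x_2),\ x\in D\bigr\}.$$ For $i=1,2$ let $u_i(\cdot)$ and $o_i(\cdot)$ be piecewise affine under- and over-estimators, respectively, of $f_i(\cdot)$ on $[x_i^L,x_i^U]$, and let $\mathcal{H}\subseteq[x^L,x^U]$ be an axis-aligned region with $D\subseteq\mathcal{H}$ (an axis-aligned outer-approximation of $D$). Let $\mathcal{D}$ be a finite collection of rectangles covering $[x^L,x^U]$ such that for every $H\in\mathcal{D}$ the four functions $u_1,o_1,u_2,o_2$ are affine over $H$. Define $$\mathcal{R}:=\operatorname{conv}\bigl\{(x,t_1t_2) : x\in\mathcal{H},\ u_i(x_i)\le t_i\le o_i(x_i)\ \text{for } i=1,2\bigr\},$$ $$\mathcal{Q}:=\bigcup_{H\in\mathcal{D}}\bigl\{(x,t_1t_2) : x\in\operatorname{corner}(\mathcal{H}\cap H),\ t_i\in\{u_i(x_i),o_i(x_i)\}\ \text{for } i=1,2\bigr\}.$$ Then $\mathcal{R}$ is a convex relaxation of $\mathcal{G}$ (that is, $\mathcal{R}$ is convex and $\mathcal{G}\subseteq\mathcal{R}$), and $\mathcal{R}=\operatorname{conv}(\mathcal{Q})$.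
   Context: A planar region is axis-aligned if it is a finite union of closed bounded rectangles with sides parallel to the coordinate axes (degenerate rectangles may arise when intersecting); the rectangles in $\mathcal{D}$ are closed, axis-parallel, contained in $[x^L,x^U]$ and have nonempty interior. A point $v=(v_1,v_2)$ is a corner point of an axis-aligned region $A$ if for each $i\in\{1,2\}$, with $i'$ the other index, $v_i$ is an extreme point of $\operatorname{conv}\{x_i : x\in A,\ x_{i'}=v_{i'}\}$; the set of corner points is $\operatorname{corner}(A)$. Convention for discontinuities: the piecewise affine functions $u_i,o_i$ may be discontinuous at breakpoints. "Affine over $H$" means that on the interior of the $i$-th side of $H$ they coincide with affine functions $u_i^H,o_i^H$. In the part of $\mathcal{Q}$ indexed by $H$, the values $u_i(x_i),o_i(x_i)$ are those of $u_i^H,o_i^H$, including at endpoints of the sides of $H$. In the definition of $\mathcal{R}$, and as estimators of $f_i$, at a point $x$ belonging to several rectangles of $\mathcal{D}$ the smallest underestimator value $\min_{H\ni x}u_i^H(x_i)$ and the largest overestimator value $\max_{H\ni x}o_i^H(x_i)$ over the rectangles $H$ containing $x$ are used. If $u_i,o_i$ are continuous, this convention is vacuous. *)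

theory Defs
  imports "HOL-Analysis.Analysis"
begin

text \<open>
  The plane is \<^typ>\<open>real^2\<close>; the index set \<open>{1,2}\<close> is the type \<^typ>\<open>2\<close>, and
  \<open>\<real>\<^sup>3\<close> is represented as \<^typ>\<open>(real^2) \<times> real\<close>. Univariate functions are total, but only
  their values on the relevant intervals matter.
\<close>

text \<open>Degenerate (and empty) boxes are allowed among the constituents, so that the class is
  closed under intersection with boxes.\<close>

definition axis_aligned :: "(real^2) set \<Rightarrow> bool" where
  "axis_aligned A \<longleftrightarrow>
     (\<exists>F. finite F \<and> (\<forall>S\<in>F. \<exists>a b. S = cbox a b) \<and> A = \<Union>F)"

definition proper_rectangle :: "(real^2) set \<Rightarrow> bool" where
  "proper_rectangle H \<longleftrightarrow> (\<exists>a b. H = cbox a b) \<and> interior H \<noteq> {}"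

definition corner :: "(real^2) set \<Rightarrow> (real^2) set" where
  "corner A = {v. \<forall>i i'. i \<noteq> i' \<longrightarrow>
     (v $ i) extreme_point_of (convex hull {x $ i | x. x \<in> A \<and> x $ i' = v $ i'})}"

definition affine_fun :: "(real \<Rightarrow> real) \<Rightarrow> bool" where
  "affine_fun h \<longleftrightarrow> (\<exists>m c. h = (\<lambda>s. m * s + c))"

text \<open>No condition is imposed at the breakpoints, so jumps are allowed there.\<close>

definition piecewise_affine_on :: "real \<Rightarrow> real \<Rightarrow> (real \<Rightarrow> real) \<Rightarrow> bool" where
  "piecewise_affine_on a b g \<longleftrightarrow>
     (\<exists>P. finite P \<and> (\<forall>c d. a \<le> c \<and> c < d \<and> d \<le> b \<and> {c<..<d} \<inter> P = {} \<longrightarrow>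
        (\<exists>h. affine_fun h \<and> (\<forall>s\<in>{c<..<d}. g s = h s))))"

definition side :: "(real^2) set \<Rightarrow> 2 \<Rightarrow> real set" where
  "side H i = (\<lambda>x. x $ i) ` H"

definition affine_over :: "(real^2) set \<Rightarrow> 2 \<Rightarrow> (real \<Rightarrow> real) \<Rightarrow> bool" where
  "affine_over H i g \<longleftrightarrow>
     (\<exists>h. affine_fun h \<and> (\<forall>s\<in>interior (side H i). g s = h s))"

text \<open>The affine function \<open>g\<^sup>H\<close> coinciding with \<open>g\<close> on the interior of the \<open>i\<close>-th side of
  \<open>H\<close>. At the endpoints of that side its value may differ from that of \<open>g\<close>.\<close>

definition affine_piece :: "(real^2) set \<Rightarrow> 2 \<Rightarrow> (real \<Rightarrow> real) \<Rightarrow> real \<Rightarrow> real" where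
  "affine_piece H i g =
     (THE h. affine_fun h \<and> (\<forall>s\<in>interior (side H i). g s = h s))"

lemma affine_piece:
  assumes "proper_rectangle H" "affine_over H i g"
  shows "affine_fun (affine_piece H i g)"
    and "\<And>s. s \<in> interior (side H i) \<Longrightarrow> affine_piece H i g s = g s"
proof -
  let ?P = "\<lambda>h. affine_fun h \<and> (\<forall>s\<in>interior (side H i). g s = h s)"
  obtain y where "y \<in> interior H"
    using assms(1) by (auto simp: proper_rectangle_def)
  moreover have "open ((\<lambda>x::real^2. x $ i) ` interior H)"
    by (rule open_image_vec_nth) simp
  ultimately have "y $ i \<in> interior (side H i)"
    unfolding side_def using interior_subset[of H] by (intro interiorI) auto
  then obtain e where e: "e > 0" "ball (y $ i) e \<subseteq> interior (side H i)"
    using open_contains_ball open_interior by blast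
  then have pts: "y $ i \<in> interior (side H i)" "y $ i + e/2 \<in> interior (side H i)"
    by (auto simp: dist_real_def subset_iff)
  have unique: "h = k" if h: "?P h" and k: "?P k" for h k
  proof -
    obtain m c m' c' where hk: "h = (\<lambda>s. m * s + c)" "k = (\<lambda>s. m' * s + c')"
      using h k by (auto simp: affine_fun_def)
    have "h (y $ i) = k (y $ i)" "h (y $ i + e/2) = k (y $ i + e/2)"
      using h k pts by (metis)+
    then have eq: "m * y $ i + c = m' * y $ i + c'"
      and "m * (y $ i + e/2) + c = m' * (y $ i + e/2) + c'"
      by (auto simp: hk)
    then have "m * (e/2) = m' * (e/2)"
      unfolding distrib_left by linarith
    with e(1) have "m = m'" by simp
    with eq show ?thesis by (simp add: hk)
  qed
  have "\<exists>!h. ?P h"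
    using assms(2) unique unfolding affine_over_def by blast
  then have "?P (affine_piece H i g)"
    unfolding affine_piece_def by (rule theI')
  then show "affine_fun (affine_piece H i g)"
    and "\<And>s. s \<in> interior (side H i) \<Longrightarrow> affine_piece H i g s = g s" by auto
qed

text \<open>Values of a possibly discontinuous under- or overestimator \<open>g\<close> of the \<open>i\<close>-th factor at a
  point \<open>x\<close>: the least (resp. greatest) value over all rectangles of the collection that contain
  \<open>x\<close>. Where \<open>g\<close> is continuous at \<open>x $ i\<close>, this is \<open>g (x $ i)\<close>.\<close>

definition under_value :: "(real^2) set set \<Rightarrow> 2 \<Rightarrow> (real \<Rightarrow> real) \<Rightarrow> real^2 \<Rightarrow> real" where
  "under_value \<D> i g x = Min {affine_piece H i g (x $ i) | H. H \<in> \<D> \<and> x \<in> H}"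

definition over_value :: "(real^2) set set \<Rightarrow> 2 \<Rightarrow> (real \<Rightarrow> real) \<Rightarrow> real^2 \<Rightarrow> real" where
  "over_value \<D> i g x = Max {affine_piece H i g (x $ i) | H. H \<in> \<D> \<and> x \<in> H}"

definition product_graph :: "(2 \<Rightarrow> real \<Rightarrow> real) \<Rightarrow> (real^2) set \<Rightarrow> ((real^2) \<times> real) set" where
  "product_graph f D = {(x, \<mu>). \<mu> = f 1 (x $ 1) * f 2 (x $ 2) \<and> x \<in> D}"

definition relaxation_set ::
  "(real^2) set set \<Rightarrow> (2 \<Rightarrow> real \<Rightarrow> real) \<Rightarrow> (2 \<Rightarrow> real \<Rightarrow> real) \<Rightarrow> (real^2) set
     \<Rightarrow> ((real^2) \<times> real) set" where
  "relaxation_set \<D> un ov \<H> = convex hull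
     {(x, t $ 1 * t $ 2) | x (t :: real^2). x \<in> \<H> \<and>
        (\<forall>i. under_value \<D> i (un i) x \<le> t $ i \<and> t $ i \<le> over_value \<D> i (ov i) x)}"

definition corner_set ::
  "(real^2) set set \<Rightarrow> (2 \<Rightarrow> real \<Rightarrow> real) \<Rightarrow> (2 \<Rightarrow> real \<Rightarrow> real) \<Rightarrow> (real^2) set
     \<Rightarrow> ((real^2) \<times> real) set" where
  "corner_set \<D> un ov \<H> = (\<Union>H\<in>\<D>.
     {(x, t $ 1 * t $ 2) | x (t :: real^2). x \<in> corner (\<H> \<inter> H) \<and>
        (\<forall>i. t $ i \<in> {affine_piece H i (un i) (x $ i), affine_piece H i (ov i) (x $ i)})})"

definition convex_relaxation :: "'a::real_vector set \<Rightarrow> 'a set \<Rightarrow> bool" where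
  "convex_relaxation R G \<longleftrightarrow> convex R \<and> G \<subseteq> R"

end

theory Submission
  imports Defs
begin

text \<open>
  The inclusion \<open>conv \<Q> \<subseteq> \<R>\<close> and the inclusion of the graph are direct, once the affine pieces of
  the under- and overestimator on a rectangle are known to be ordered (\<open>affine_piece_mono\<close>). For
  \<open>\<R> \<subseteq> conv \<Q>\<close> there are three reductions.

  \<^item> For fixed \<open>x\<close>, the product \<open>t\<^sub>1 t\<^sub>2\<close> is affine in each factor, so it suffices to treat each
    \<open>t\<^sub>i\<close> at an end of its range. There \<open>t\<^sub>i\<close> is the value at \<open>x\<^sub>i\<close> of an affine piece belonging to
    some rectangle containing \<open>x\<close>, a priori a different one for each \<open>i\<close>.

  \<^item> A single rectangle carries both pieces (\<open>common_rectangle\<close>): an affine piece is determined by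
    any open interval of its side, so the rectangle chosen for \<open>i\<close> may be replaced by any other whose
    side overlaps it near \<open>x\<^sub>i\<close>. The two choices together thus only prescribe a quadrant at \<open>x\<close>; and
    since finitely many closed rectangles cover the box, one of them contains \<open>x\<close> and also points
    of that quadrant.

  \<^item> On one rectangle \<open>H\<close> the function \<open>x \<mapsto> h\<^sub>1(x\<^sub>1) h\<^sub>2(x\<^sub>2)\<close>, with \<open>h\<^sub>i\<close> affine, is affine along every
    axis-parallel segment. Its graph over the compact set \<open>\<H> \<inter> H\<close> is compact, so by Krein--Milman
    it lies in the convex hull of the extreme points of its own hull. A point of the graph over a
    non-corner lies strictly inside a segment between two other points of the graph, hence is not
    extreme (\<open>graph_in_hull_corners\<close>).
\<close>

section \<open>Sides of rectangles\<close>

lemma side_props: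
  assumes "proper_rectangle H"
  shows "convex (side H i)" "interior (side H i) \<noteq> {}"
proof -
  obtain a b where H: "H = cbox a b"
    using assms by (auto simp: proper_rectangle_def)
  show "convex (side H i)"
    unfolding side_def H by (intro convex_linear_image) (auto intro: bounded_linear.linear bounded_linear_vec_nth)
  have "open ((\<lambda>x::real^2. x $ i) ` interior H)"
    by (rule open_image_vec_nth) simp
  moreover have "(\<lambda>x. x $ i) ` interior H \<subseteq> side H i"
    unfolding side_def using interior_subset by blast
  ultimately have "(\<lambda>x. x $ i) ` interior H \<subseteq> interior (side H i)"
    by (simp add: interior_maximal)
  then show "interior (side H i) \<noteq> {}"
    using assms by (auto simp: proper_rectangle_def)
qed

lemma side_subset_closure_interior:
  assumes "proper_rectangle H"
  shows "side H i \<subseteq> closure (interior (side H i))"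
  using convex_closure_interior[OF side_props[OF assms, of i]] closure_subset by blast

section \<open>Affine pieces on overlapping rectangles\<close>

lemma affine_fun_eqI:
  assumes "affine_fun h" "affine_fun k" and "open S" "S \<noteq> {}"
    and eq: "\<And>s. s \<in> S \<Longrightarrow> h s = k s"
  shows "h = k"
proof -
  obtain s e where s: "s \<in> S" "e > 0" "ball s e \<subseteq> S"
    using assms(3,4) open_contains_ball by blast
  have "s + e/2 \<in> S"
    using s by (auto simp: subset_iff dist_real_def)
  obtain m c m' c' where hk: "h = (\<lambda>s. m * s + c)" "k = (\<lambda>s. m' * s + c')"
    using assms(1,2) by (auto simp: affine_fun_def)
  have 1: "m * s + c = m' * s + c'" "m * (s + e/2) + c = m' * (s + e/2) + c'"
    using eq[OF s(1)] eq[OF \<open>s + e/2 \<in> S\<close>] by (auto simp: hk)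
  then have "m * (e/2) = m' * (e/2)"
    unfolding distrib_left by linarith
  with s(2) have "m = m'" by simp
  with 1 show ?thesis by (simp add: hk)
qed

lemma affine_fun_continuous: "affine_fun h \<Longrightarrow> continuous_on A h"
  by (auto simp: affine_fun_def intro!: continuous_intros)

lemma affine_piece_eq:
  assumes H: "proper_rectangle H" "affine_over H i g"
    and K: "proper_rectangle K" "affine_over K i g"
    and s: "s \<in> interior (side H i)" "s \<in> side K i"
  shows "affine_piece K i g = affine_piece H i g"
proof (rule affine_fun_eqI)
  let ?S = "interior (side H i) \<inter> interior (side K i)"
  show "affine_fun (affine_piece K i g)" "affine_fun (affine_piece H i g)"
    using affine_piece(1) H K by blast+
  show "open ?S" by auto
  \<comment> \<open>\<open>s\<close> itself may be an endpoint of the side of \<open>K\<close>, but interior points accumulate at it.\<close>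
  have "s \<in> closure (interior (side K i))"
    using side_subset_closure_interior[OF K(1)] s(2) by blast
  then show "?S \<noteq> {}"
    using open_Int_closure_eq_empty[of "interior (side H i)" "interior (side K i)"] s(1) by auto
  show "affine_piece K i g t = affine_piece H i g t" if "t \<in> ?S" for t
    using that affine_piece(2) H K by auto
qed

text \<open>The family \<open>K\<close> picks, for each coordinate \<open>i\<close>, a rectangle at \<open>x\<close> whose \<open>i\<close>-th affine piece
  is wanted. A path that leaves \<open>x\<close> into the interiors of the sides \<open>side (K i) i\<close> stays in the covered
  box, so some rectangle \<open>H\<close> contains \<open>x\<close> and a point of the path past its start; then each side of \<open>H\<close>
  overlaps the corresponding side of \<open>K i\<close>.\<close>

lemma common_rectangle:
  fixes K :: "2 \<Rightarrow> (real^2) set"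
  assumes fin: "finite \<D>" and cover: "cbox l u \<subseteq> \<Union>\<D>"
    and rect: "\<And>H. H \<in> \<D> \<Longrightarrow> proper_rectangle H \<and> H \<subseteq> cbox l u"
    and K: "\<And>i. K i \<in> \<D>" "\<And>i. x \<in> K i"
  obtains H where "H \<in> \<D>" "x \<in> H"
    "\<And>i g. affine_over H i g \<Longrightarrow> affine_over (K i) i g \<Longrightarrow>
       affine_piece H i g = affine_piece (K i) i g"
proof -
  have "\<forall>i. \<exists>s. s \<in> interior (side (K i) i)"
    using side_props(2) rect K(1) by blast
  then obtain w where w: "\<And>i. w i \<in> interior (side (K i) i)" by metis
  \<comment> \<open>\<open>y\<close> marks the quadrant at \<open>x\<close> selected by the two rectangles; it may lie on a
    coordinate line through \<open>x\<close> if \<open>x $ i\<close> is already interior to the side, which is harmless.\<close>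
  define y :: "real^2" where "y = (\<chi> i. w i)"
  have "w i \<in> side (K i) i" for i
    using w interior_subset by blast
  moreover have "side (K i) i \<subseteq> {l $ i..u $ i}" for i
  proof
    fix s assume "s \<in> side (K i) i"
    then obtain z where "z \<in> K i" "s = z $ i" by (auto simp: side_def)
    moreover have "z \<in> cbox l u" using \<open>z \<in> K i\<close> rect[OF K(1)] by blast
    ultimately show "s \<in> {l $ i..u $ i}" by (simp add: mem_box_cart)
  qed
  ultimately have "w i \<in> {l $ i..u $ i}" for i by blast
  then have y_box: "y \<in> cbox l u"
    by (simp add: y_def mem_box_cart)
  have x_box: "x \<in> cbox l u" using rect K by blast
  define p where "p e = x - e *\<^sub>R (x - y)" for e :: real
  have p_box: "p e \<in> cbox l u" if "e \<in> {0<..1}" for e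
  proof -
    have "(1 - e) *\<^sub>R x + e *\<^sub>R y \<in> cbox l u"
      using that by (intro convexD_alt[OF convex_box(1) x_box y_box]) auto
    then show ?thesis by (simp add: p_def algebra_simps)
  qed
  have "p ` closure {0<..1} \<subseteq> closure (p ` {0<..1})"
    by (rule image_closure_subset) (auto simp: p_def closure_subset intro!: continuous_intros)
  moreover have "p 0 = x" by (simp add: p_def)
  ultimately have "x \<in> closure (p ` {0<..1})"
    by (metis (no_types) atLeastAtMost_iff closure_greaterThanAtMost image_eqI less_eq_real_def
        subsetD zero_less_one)
  \<comment> \<open>The closed set on the right contains the path \<open>p\<close>, hence also its end \<open>x\<close>.\<close>
  moreover have "closure (p ` {0<..1}) \<subseteq> (\<Union>H\<in>\<D>. closure (H \<inter> p ` {0<..1}))"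
  proof (rule closure_minimal)
    show "p ` {0<..1} \<subseteq> (\<Union>H\<in>\<D>. closure (H \<inter> p ` {0<..1}))"
    proof
      fix z assume z: "z \<in> p ` {0<..1}"
      then have "z \<in> \<Union>\<D>" using p_box cover by blast
      then obtain H where H: "H \<in> \<D>" "z \<in> H \<inter> p ` {0<..1}" using z by blast
      have "z \<in> closure (H \<inter> p ` {0<..1})" by (rule subsetD[OF closure_subset H(2)])
      with H(1) show "z \<in> (\<Union>H\<in>\<D>. closure (H \<inter> p ` {0<..1}))"
        by (rule UN_I)
    qed
    show "closed (\<Union>H\<in>\<D>. closure (H \<inter> p ` {0<..1}))"
      using fin by (intro closed_UN) auto
  qed
  ultimately obtain H where H: "H \<in> \<D>" "x \<in> closure (H \<inter> p ` {0<..1})"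
    by blast
  have "closed H"
    using rect[OF H(1)] by (auto simp: proper_rectangle_def)
  then have xH: "x \<in> H"
    using H(2) closure_mono[of "H \<inter> p ` {0<..1}" H] by (auto simp: closure_closed)
  obtain e where e: "e \<in> {0<..1}" "p e \<in> H"
  proof -
    have "H \<inter> p ` {0<..1} \<noteq> {}" using H(2) by auto
    then show thesis using that by blast
  qed
  show thesis
  proof (rule that[OF H(1) xH])
    fix i g assume g: "affine_over H i g" "affine_over (K i) i g"
    have "x $ i \<in> side (K i) i" using K(2) by (auto simp: side_def)
    then have "x $ i - e *\<^sub>R (x $ i - w i) \<in> interior (side (K i) i)"
      using e(1) rect[OF K(1)] w
      by (intro mem_interior_closure_convex_shrink side_props(1)) (auto intro: closure_subset[THEN subsetD])
    moreover have "p e $ i \<in> side H i" using e(2) by (auto simp: side_def)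
    ultimately show "affine_piece H i g = affine_piece (K i) i g"
      using g rect[OF H(1)] rect[OF K(1)]
      by (intro affine_piece_eq[where s = "p e $ i"]) (auto simp: p_def y_def)
  qed
qed

section \<open>Order of the estimators\<close>

lemma
  assumes "finite \<D>" "H \<in> \<D>" "x \<in> H"
  shows under_value_le: "under_value \<D> i g x \<le> affine_piece H i g (x $ i)"
    and over_value_ge: "affine_piece H i g (x $ i) \<le> over_value \<D> i g x"
  unfolding under_value_def over_value_def using assms
  by (auto intro!: Min_le Max_ge)

lemma
  assumes "finite \<D>" "x \<in> \<Union>\<D>"
  shows under_value_attained:
      "\<exists>H\<in>\<D>. x \<in> H \<and> under_value \<D> i g x = affine_piece H i g (x $ i)"
    and over_value_attained:
      "\<exists>H\<in>\<D>. x \<in> H \<and> over_value \<D> i g x = affine_piece H i g (x $ i)"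
proof -
  let ?V = "{affine_piece H i g (x $ i) | H. H \<in> \<D> \<and> x \<in> H}"
  have "finite ?V" "?V \<noteq> {}" using assms by auto
  then have "Min ?V \<in> ?V" "Max ?V \<in> ?V" by (rule Min_in, rule Max_in)
  then show "\<exists>H\<in>\<D>. x \<in> H \<and> under_value \<D> i g x = affine_piece H i g (x $ i)"
    and "\<exists>H\<in>\<D>. x \<in> H \<and> over_value \<D> i g x = affine_piece H i g (x $ i)"
    unfolding under_value_def over_value_def by blast+
qed

text \<open>The estimators are ordered only through the extremal values over all rectangles at a point.
  Over the interior of a side of \<open>H\<close>, however, all rectangles at the point have the same affine
  piece as \<open>H\<close>, and the order extends to the endpoints by continuity.\<close>

lemma affine_piece_mono:
  assumes fin: "finite \<D>" and rect: "\<And>H. H \<in> \<D> \<Longrightarrow> proper_rectangle H"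
    and g: "\<And>H. H \<in> \<D> \<Longrightarrow> affine_over H i g"
    and k: "\<And>H. H \<in> \<D> \<Longrightarrow> affine_over H i k"
    and le: "\<And>x. x \<in> \<Union>\<D> \<Longrightarrow> under_value \<D> i g x \<le> over_value \<D> i k x"
    and H: "H \<in> \<D>" "s \<in> side H i"
  shows "affine_piece H i g s \<le> affine_piece H i k s"
proof -
  let ?g = "affine_piece H i g" and ?k = "affine_piece H i k"
  have "?g t \<le> ?k t" if t: "t \<in> interior (side H i)" for t
  proof -
    obtain x where x: "x \<in> H" "x $ i = t"
      using t interior_subset[of "side H i"] by (auto simp: side_def)
    have eq: "affine_piece K i g = ?g" "affine_piece K i k = ?k" if "K \<in> \<D>" "x \<in> K" for K
    proof -
      have "t \<in> side K i" using that(2) x(2) by (auto simp: side_def)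
      then show "affine_piece K i g = ?g" "affine_piece K i k = ?k"
        using affine_piece_eq rect g k H(1) that(1) t by blast+
    qed
    have xD: "x \<in> \<Union>\<D>" using x(1) H(1) by blast
    show ?thesis
      using le[OF xD] under_value_attained[OF fin xD, of i g] over_value_attained[OF fin xD, of i k]
        eq x(2) by auto
  qed
  moreover have "closed {t. ?g t \<le> ?k t}"
    using affine_piece(1) rect g k H(1) by (intro closed_Collect_le affine_fun_continuous) blast+
  ultimately have "closure (interior (side H i)) \<subseteq> {t. ?g t \<le> ?k t}"
    by (intro closure_minimal) auto
  then show ?thesis
    using side_subset_closure_interior[OF rect[OF H(1)]] H(2) by blast
qed

section \<open>Corners of compact regions\<close>

lemma corner_subset: "corner A \<subseteq> A"
proof
  fix v assume v: "v \<in> corner A"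
  have "(1::2) \<noteq> 2" by simp
  with v have "(v $ 1) extreme_point_of (convex hull {x $ 1 | x. x \<in> A \<and> x $ 2 = v $ 2})"
    unfolding corner_def by blast
  then have "v $ 1 \<in> {x $ 1 | x. x \<in> A \<and> x $ 2 = v $ 2}"
    by (rule extreme_point_of_convex_hull)
  then obtain x where "x \<in> A" "x $ 1 = v $ 1" "x $ 2 = v $ 2"
    by auto
  moreover from this have "x = v" by (simp add: vec_eq_iff forall_2)
  ultimately show "v \<in> A" by simp
qed

lemma convex_hull_real_between:
  fixes a :: real
  assumes "a \<in> convex hull S"
  obtains p q where "p \<in> S" "q \<in> S" "p \<le> a" "a \<le> q"
proof -
  have "\<exists>p\<in>S. p \<le> a"
  proof (rule ccontr)
    assume "\<not> ?thesis"
    then have "S \<subseteq> {a<..}" by auto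
    then have "convex hull S \<subseteq> {a<..}" by (rule hull_minimal) simp
    with assms show False by auto
  qed
  moreover have "\<exists>q\<in>S. a \<le> q"
  proof (rule ccontr)
    assume "\<not> ?thesis"
    then have "S \<subseteq> {..<a}" by auto
    then have "convex hull S \<subseteq> {..<a}" by (rule hull_minimal) simp
    with assms show False by auto
  qed
  ultimately show thesis using that by blast
qed

lemma non_corner_between:
  assumes v: "v \<in> A" "v \<notin> corner A"
  obtains i p q where "p \<in> A" "q \<in> A" "p $ i < v $ i" "v $ i < q $ i"
    "\<And>j. j \<noteq> i \<Longrightarrow> p $ j = v $ j" "\<And>j. j \<noteq> i \<Longrightarrow> q $ j = v $ j"
proof -
  obtain i i' where ii: "i \<noteq> i'" and
    not_ext: "\<not> (v $ i) extreme_point_of (convex hull {x $ i | x. x \<in> A \<and> x $ i' = v $ i'})"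
      (is "\<not> _ extreme_point_of (convex hull ?S)")
    using v(2) unfolding corner_def by blast
  have only: "j = i'" if "j \<noteq> i" for j
    using that ii exhaust_2[of i] exhaust_2[of i'] exhaust_2[of j] by auto
  have "v $ i \<in> convex hull ?S" using v(1) by (intro hull_inc) auto
  with not_ext obtain a b where
    ab: "a \<in> convex hull ?S" "b \<in> convex hull ?S" "v $ i \<in> open_segment a b"
    unfolding extreme_point_of_def by blast
  then obtain c d where
    cd: "c \<in> convex hull ?S" "d \<in> convex hull ?S" "c < v $ i" "v $ i < d"
    by (auto simp: open_segment_eq_real_ivl split: if_splits)
  obtain r where "r \<in> ?S" "r \<le> c" using convex_hull_real_between[OF cd(1)] .
  moreover obtain s where "s \<in> ?S" "d \<le> s" using convex_hull_real_between[OF cd(2)] .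
  ultimately obtain p q where "p \<in> A" "q \<in> A" "p $ i' = v $ i'" "q $ i' = v $ i'"
      "p $ i \<le> c" "d \<le> q $ i" by auto
  with cd(3,4) only show thesis by (intro that[of p q i]) force+
qed

lemma graph_in_hull_corners:
  fixes h :: "2 \<Rightarrow> real \<Rightarrow> real"
  assumes A: "compact A" and h: "\<And>i. affine_fun (h i)" and x: "x \<in> A"
  shows "(x, h 1 (x $ 1) * h 2 (x $ 2)) \<in>
    convex hull ((\<lambda>v. (v, h 1 (v $ 1) * h 2 (v $ 2))) ` corner A)"
proof -
  define \<phi> where "\<phi> v = (v, h 1 (v $ 1) * h 2 (v $ 2))" for v :: "real^2"
  have "\<forall>i. \<exists>m c. h i = (\<lambda>s. m * s + c)"
    using h by (simp add: affine_fun_def)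
  then obtain m c where mc: "\<And>i. h i = (\<lambda>s. m i * s + c i)" by metis
  have "continuous_on A \<phi>"
    unfolding \<phi>_def mc by (intro continuous_intros)
  then have comp: "compact (convex hull (\<phi> ` A))"
    using A by (intro compact_convex_hull compact_continuous_image)
  have ext: "e \<in> \<phi> ` corner A" if e: "e extreme_point_of (convex hull (\<phi> ` A))" for e
  proof -
    obtain v where v: "v \<in> A" "e = \<phi> v"
      using extreme_point_of_convex_hull[OF e] by blast
    have "v \<in> corner A"
    proof (rule ccontr)
      assume "v \<notin> corner A"
      with v(1) obtain i p q where pq: "p \<in> A" "q \<in> A" "p $ i < v $ i" "v $ i < q $ i"
        "\<And>j. j \<noteq> i \<Longrightarrow> p $ j = v $ j" "\<And>j. j \<noteq> i \<Longrightarrow> q $ j = v $ j"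
        by (rule non_corner_between) blast
      have "v $ i \<in> open_segment (p $ i) (q $ i)"
        using pq by (auto simp: open_segment_eq_real_ivl)
      then obtain \<theta> where \<theta>: "0 < \<theta>" "\<theta> < 1" "v $ i = (1 - \<theta>) * p $ i + \<theta> * q $ i"
        by (auto simp: in_segment)
      have coord: "v $ j = (1 - \<theta>) * p $ j + \<theta> * q $ j" for j
        using \<theta>(3) pq(5,6)[of j] by (cases "j = i") (auto simp: algebra_simps)
      have factor: "h j (v $ j) = (1 - \<theta>) * h j (p $ j) + \<theta> * h j (q $ j)" for j
        unfolding coord[of j] mc by (simp add: algebra_simps)
      \<comment> \<open>Only the factor with index \<open>i\<close> varies along the segment, so the product is affine on it.\<close>
      have prod: "h 1 (v $ 1) * h 2 (v $ 2) =
          (1 - \<theta>) * (h 1 (p $ 1) * h 2 (p $ 2)) + \<theta> * (h 1 (q $ 1) * h 2 (q $ 2))"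
      proof (cases "i = 1")
        case True
        then have "p $ 2 = v $ 2" "q $ 2 = v $ 2" using pq(5,6)[of 2] by auto
        then show ?thesis unfolding factor[of 1] by (simp add: algebra_simps)
      next
        case False
        then have "p $ 1 = v $ 1" "q $ 1 = v $ 1" using pq(5,6)[of 1] by auto
        then show ?thesis unfolding factor[of 2] by (simp add: algebra_simps)
      qed
      have "\<phi> v = (1 - \<theta>) *\<^sub>R \<phi> p + \<theta> *\<^sub>R \<phi> q"
        using coord prod by (simp add: \<phi>_def vec_eq_iff)
      moreover have "\<phi> p \<noteq> \<phi> q" using pq(3,4) by (auto simp: \<phi>_def)
      ultimately have "\<phi> v \<in> open_segment (\<phi> p) (\<phi> q)"
        using \<theta>(1,2) by (auto simp: in_segment)
      moreover have "\<phi> p \<in> convex hull (\<phi> ` A)" "\<phi> q \<in> convex hull (\<phi> ` A)"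
        using pq(1,2) by (auto intro: hull_inc)
      ultimately show False
        using e v(2) unfolding extreme_point_of_def by blast
    qed
    with v(2) show ?thesis by blast
  qed
  have "\<phi> x \<in> convex hull (\<phi> ` A)" using x by (auto intro: hull_inc)
  also have "\<dots> = convex hull {e. e extreme_point_of (convex hull (\<phi> ` A))}"
    by (rule Krein_Milman_Minkowski[OF comp convex_convex_hull])
  also have "\<dots> \<subseteq> convex hull (\<phi> ` corner A)"
    using ext by (intro hull_mono) auto
  finally show ?thesis by (simp add: \<phi>_def)
qed

lemma axis_aligned_compact: "axis_aligned A \<Longrightarrow> compact A"
  by (auto simp: axis_aligned_def intro!: compact_Union)

section \<open>Products over a box of factors\<close>

lemma convex_scaled_between:
  fixes l t u s :: real
  assumes C: "convex C" and t: "l \<le> t" "t \<le> u"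
    and ends: "(x, l * s) \<in> C" "(x, u * s) \<in> C"
  shows "(x, t * s) \<in> C"
proof -
  have "t \<in> closed_segment l u" using t by (simp add: closed_segment_eq_real_ivl)
  then obtain \<theta> where \<theta>: "0 \<le> \<theta>" "\<theta> \<le> 1" "t = (1 - \<theta>) * l + \<theta> * u"
    by (auto simp: in_segment)
  have "(1 - \<theta>) *\<^sub>R (x, l * s) + \<theta> *\<^sub>R (x, u * s) \<in> C"
    using C ends \<theta> by (intro convexD_alt) auto
  moreover have "(1 - \<theta>) *\<^sub>R (x, l * s) + \<theta> *\<^sub>R (x, u * s) = (x, t * s)"
    by (simp add: \<theta>(3) algebra_simps)
  ultimately show ?thesis by simp
qed

lemma convex_product_box:
  fixes l t u :: "2 \<Rightarrow> real"
  assumes C: "convex C" and t: "\<And>i. l i \<le> t i" "\<And>i. t i \<le> u i"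
    and vertices: "\<And>w. (\<And>i. w i \<in> {l i, u i}) \<Longrightarrow> (x, w 1 * w 2) \<in> C"
  shows "(x, t 1 * t 2) \<in> C"
proof -
  have vertex: "(x, a * b) \<in> C" if "a \<in> {l 1, u 1}" "b \<in> {l 2, u 2}" for a b
  proof -
    have "(if i = 1 then a else b) \<in> {l i, u i}" for i :: 2
      using that exhaust_2[of i] by auto
    from vertices[of "\<lambda>i. if i = 1 then a else b", OF this] show ?thesis by simp
  qed
  have "(x, t 2 * b) \<in> C" if "b \<in> {l 1, u 1}" for b
    using that by (intro convex_scaled_between[OF C t]) (auto simp: mult.commute[of _ b] intro!: vertex)
  then show ?thesis
    by (intro convex_scaled_between[OF C t]) (auto simp: mult.commute)
qed

theorem theorem5:
  fixes xL xU :: "real^2"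
    and f un ov :: "2 \<Rightarrow> real \<Rightarrow> real"
    and D \<H> :: "(real^2) set"
    and \<D> :: "(real^2) set set"
  assumes bounds: "\<And>i. xL $ i < xU $ i"
    and D: "D \<subseteq> cbox xL xU"
    and un_pw: "\<And>i. piecewise_affine_on (xL $ i) (xU $ i) (un i)"
    and ov_pw: "\<And>i. piecewise_affine_on (xL $ i) (xU $ i) (ov i)"
    and un_est: "\<And>i x. x \<in> cbox xL xU \<Longrightarrow> under_value \<D> i (un i) x \<le> f i (x $ i)"
    and ov_est: "\<And>i x. x \<in> cbox xL xU \<Longrightarrow> f i (x $ i) \<le> over_value \<D> i (ov i) x"
    and region: "axis_aligned \<H>" "\<H> \<subseteq> cbox xL xU" "D \<subseteq> \<H>"
    and fin: "finite \<D>"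
    and rect: "\<And>H. H \<in> \<D> \<Longrightarrow> proper_rectangle H \<and> H \<subseteq> cbox xL xU"
    and cover: "cbox xL xU \<subseteq> \<Union>\<D>"
    and affine: "\<And>H i. H \<in> \<D> \<Longrightarrow> affine_over H i (un i) \<and> affine_over H i (ov i)"
  shows "convex_relaxation (relaxation_set \<D> un ov \<H>) (product_graph f D)
    \<and> relaxation_set \<D> un ov \<H> = convex hull (corner_set \<D> un ov \<H>)"
proof
  let ?R0 = "{(x, t $ 1 * t $ 2) | x (t :: real^2). x \<in> \<H> \<and>
        (\<forall>i. under_value \<D> i (un i) x \<le> t $ i \<and> t $ i \<le> over_value \<D> i (ov i) x)}"
  let ?Q = "corner_set \<D> un ov \<H>"
  have R: "relaxation_set \<D> un ov \<H> = convex hull ?R0"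
    by (simp add: relaxation_set_def)
  show "convex_relaxation (relaxation_set \<D> un ov \<H>) (product_graph f D)"
    unfolding convex_relaxation_def
  proof
    show "convex (relaxation_set \<D> un ov \<H>)" by (simp add: R)
    show "product_graph f D \<subseteq> relaxation_set \<D> un ov \<H>"
    proof
      fix z assume "z \<in> product_graph f D"
      then obtain x where x: "x \<in> D" "z = (x, f 1 (x $ 1) * f 2 (x $ 2))"
        by (auto simp: product_graph_def)
      define t :: "real^2" where "t = (\<chi> i. f i (x $ i))"
      have "z = (x, t $ 1 * t $ 2)" "x \<in> \<H>"
        "\<forall>i. under_value \<D> i (un i) x \<le> t $ i \<and> t $ i \<le> over_value \<D> i (ov i) x"
        using x D region(3) un_est ov_est by (auto simp: t_def)
      then have "z \<in> ?R0" by blast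
      then show "z \<in> relaxation_set \<D> un ov \<H>" unfolding R by (rule hull_inc)
    qed
  qed
  have mono: "affine_piece H i (un i) (x $ i) \<le> affine_piece H i (ov i) (x $ i)"
    if H: "H \<in> \<D>" "x \<in> H" for H i x
  proof (rule affine_piece_mono[OF fin])
    show "under_value \<D> i (un i) y \<le> over_value \<D> i (ov i) y" if "y \<in> \<Union>\<D>" for y
    proof -
      have "y \<in> cbox xL xU" using that rect by blast
      then show ?thesis using un_est ov_est order_trans by blast
    qed
    show "x $ i \<in> side H i" using H(2) by (auto simp: side_def)
  qed (use rect affine H(1) in auto)
  have "?Q \<subseteq> ?R0"
  proof
    fix z assume "z \<in> ?Q"
    then obtain H x and t :: "real^2" where H: "H \<in> \<D>" and z: "z = (x, t $ 1 * t $ 2)"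
      and x: "x \<in> corner (\<H> \<inter> H)"
      and t: "\<And>i. t $ i \<in> {affine_piece H i (un i) (x $ i), affine_piece H i (ov i) (x $ i)}"
      unfolding corner_set_def by blast
    have xH: "x \<in> \<H>" "x \<in> H" using x corner_subset by blast+
    have "under_value \<D> i (un i) x \<le> t $ i \<and> t $ i \<le> over_value \<D> i (ov i) x" for i
      using t[of i] mono[OF H xH(2), of i] under_value_le[OF fin H xH(2), of i "un i"]
        over_value_ge[OF fin H xH(2), of i "ov i"] by auto
    with z xH(1) show "z \<in> ?R0" by blast
  qed
  then have "convex hull ?Q \<subseteq> relaxation_set \<D> un ov \<H>"
    unfolding R by (rule hull_mono)
  moreover have "?R0 \<subseteq> convex hull ?Q"
  proof
    fix z assume "z \<in> ?R0"
    then obtain x and t :: "real^2" where z: "z = (x, t $ 1 * t $ 2)" and x: "x \<in> \<H>"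
      and t: "\<And>i. under_value \<D> i (un i) x \<le> t $ i" "\<And>i. t $ i \<le> over_value \<D> i (ov i) x"
      by blast
    have xD: "x \<in> \<Union>\<D>" using x region(2) cover by blast
    show "z \<in> convex hull ?Q"
      unfolding z
    proof (rule convex_product_box[OF convex_convex_hull t])
      fix w assume w: "\<And>i. w i \<in> {under_value \<D> i (un i) x, over_value \<D> i (ov i) x}"
      have "\<exists>K g. K \<in> \<D> \<and> x \<in> K \<and> g \<in> {un i, ov i} \<and> w i = affine_piece K i g (x $ i)" for i
        using w[of i] under_value_attained[OF fin xD, of i "un i"]
          over_value_attained[OF fin xD, of i "ov i"] by (metis insert_iff singletonD)
      then obtain K g where K: "\<And>i. K i \<in> \<D>" "\<And>i. x \<in> K i"
        and g: "\<And>i. g i \<in> {un i, ov i}"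
        and wK: "\<And>i. w i = affine_piece (K i) i (g i) (x $ i)"
        by metis
      obtain H where H: "H \<in> \<D>" "x \<in> H" and
        common: "\<And>i g. affine_over H i g \<Longrightarrow> affine_over (K i) i g \<Longrightarrow>
          affine_piece H i g = affine_piece (K i) i g"
        by (rule common_rectangle[where K = K, OF fin cover rect K]) blast+
      define h where "h i = affine_piece H i (g i)" for i
      have over: "affine_over L i (g i)" if "L \<in> \<D>" for L i
        using affine[OF that, of i] g[of i] by auto
      have wh: "w i = h i (x $ i)" for i
        using common[OF over over, OF H(1) K(1)] wK by (simp add: h_def)
      have "compact H" using rect[OF H(1)] by (auto simp: proper_rectangle_def)
      then have comp: "compact (\<H> \<inter> H)"
        using axis_aligned_compact[OF region(1)] by (rule compact_Int[rotated])
      have aff: "affine_fun (h i)" for i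
        unfolding h_def using affine_piece(1) rect[OF H(1)] over[OF H(1)] by blast
      have "(x, h 1 (x $ 1) * h 2 (x $ 2)) \<in>
          convex hull ((\<lambda>v. (v, h 1 (v $ 1) * h 2 (v $ 2))) ` corner (\<H> \<inter> H))"
        by (rule graph_in_hull_corners[OF comp aff]) (use x H(2) in simp)
      also have "\<dots> \<subseteq> convex hull ?Q"
      proof (intro hull_mono subsetI)
        fix y assume "y \<in> (\<lambda>v. (v, h 1 (v $ 1) * h 2 (v $ 2))) ` corner (\<H> \<inter> H)"
        then obtain v where v: "v \<in> corner (\<H> \<inter> H)" "y = (v, h 1 (v $ 1) * h 2 (v $ 2))"
          by blast
        define s :: "real^2" where "s = (\<chi> i. h i (v $ i))"
        have "s $ i \<in> {affine_piece H i (un i) (v $ i), affine_piece H i (ov i) (v $ i)}" for i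
          using g[of i] by (auto simp: s_def h_def)
        moreover have "y = (v, s $ 1 * s $ 2)"
          using v(2) by (simp add: s_def)
        ultimately show "y \<in> ?Q" using v(1) H(1) unfolding corner_set_def by blast
      qed
      finally show "(x, w 1 * w 2) \<in> convex hull ?Q" by (simp add: wh)
    qed
  qed
  then have "relaxation_set \<D> un ov \<H> \<subseteq> convex hull ?Q"
    unfolding R by (rule hull_minimal) simp
  ultimately show "relaxation_set \<D> un ov \<H> = convex hull ?Q" by blast
qed

end
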